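(* Let $H_M=(V,E)$ be a finite connected multigraph (parallel edges allowed, no self-loops) with node capacities $\kappa_v\in\mathbb{N}_{\ge0}$ for $v\in V$, and suppose that $H_M$ has a valid star coloring. Then there exists an optimal valid star coloring of $H_M$, i.e. a valid star coloring $C$ with $x(H_M,C)=x^*(H_M)$, in which any two parallel edges have the same color.
   Context: Each node $v\in V$ has its own distinct color $C(v)$. A star coloring $C$ assigns to each edge $e\in E$ a color $C(e)$ with $C(e)=C(v)$ for some endpoint $v$ of $e$; parallel edges (edges with the same two endpoints) are colored individually. For $v\in V$ let $x(H_M,C,v)$ be the number of different colors of edges incident to $v$. The star coloring $C$ is valid if $x(H_M,C,v)\le\kappa_v$ for all $v\in V$. Let $x(H_M,C)=\max_{v\in V}x(H_M,C,v)$ and let $x^*(H_M)$ be the minimum of $x(H_M,C)$ over all valid star colorings $C$. *)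

theory Defs
  imports Main
begin

text \<open>
  A multigraph has node set \<open>V\<close>, edge set \<open>E\<close> and a map \<open>ends\<close> sending each edge to the
  two-element set of its endpoints; distinct edges may have equal endpoint sets.
\<close>

definition finite_multigraph :: "'v set \<Rightarrow> 'e set \<Rightarrow> ('e \<Rightarrow> 'v set) \<Rightarrow> bool" where
  "finite_multigraph V E ends \<longleftrightarrow>
     finite V \<and> finite E \<and> (\<forall>e\<in>E. ends e \<subseteq> V \<and> card (ends e) = 2)"

definition adjacency :: "'e set \<Rightarrow> ('e \<Rightarrow> 'v set) \<Rightarrow> ('v \<times> 'v) set" where
  "adjacency E ends = {(u, v). \<exists>e\<in>E. ends e = {u, v}}"

text \<open>The empty graph does not count as connected, so maxima over the nodes are well defined.\<close>

definition connected_multigraph :: "'v set \<Rightarrow> 'e set \<Rightarrow> ('e \<Rightarrow> 'v set) \<Rightarrow> bool" where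
  "connected_multigraph V E ends \<longleftrightarrow>
     V \<noteq> {} \<and> (\<forall>u\<in>V. \<forall>v\<in>V. (u, v) \<in> (adjacency E ends)\<^sup>*)"

definition parallel_edges :: "'e set \<Rightarrow> ('e \<Rightarrow> 'v set) \<Rightarrow> 'e \<Rightarrow> 'e \<Rightarrow> bool" where
  "parallel_edges E ends e f \<longleftrightarrow> e \<in> E \<and> f \<in> E \<and> e \<noteq> f \<and> ends e = ends f"

text \<open>
  The node colors are given once and for all by a map \<open>nc\<close>, injective on \<open>V\<close>; a star coloring
  is then determined by its edge colors \<open>C\<close> (only the values on \<open>E\<close> matter).
\<close>

definition star_coloring :: "'e set \<Rightarrow> ('e \<Rightarrow> 'v set) \<Rightarrow> ('v \<Rightarrow> 'c) \<Rightarrow> ('e \<Rightarrow> 'c) \<Rightarrow> bool" where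
  "star_coloring E ends nc C \<longleftrightarrow> (\<forall>e\<in>E. \<exists>v\<in>ends e. C e = nc v)"

definition num_colors_at :: "'e set \<Rightarrow> ('e \<Rightarrow> 'v set) \<Rightarrow> ('e \<Rightarrow> 'c) \<Rightarrow> 'v \<Rightarrow> nat" where
  "num_colors_at E ends C v = card (C ` {e \<in> E. v \<in> ends e})"

definition valid_star_coloring ::
  "'v set \<Rightarrow> 'e set \<Rightarrow> ('e \<Rightarrow> 'v set) \<Rightarrow> ('v \<Rightarrow> nat) \<Rightarrow> ('v \<Rightarrow> 'c) \<Rightarrow> ('e \<Rightarrow> 'c) \<Rightarrow> bool" where
  "valid_star_coloring V E ends \<kappa> nc C \<longleftrightarrow>
     star_coloring E ends nc C \<and> (\<forall>v\<in>V. num_colors_at E ends C v \<le> \<kappa> v)"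

definition max_colors :: "'v set \<Rightarrow> 'e set \<Rightarrow> ('e \<Rightarrow> 'v set) \<Rightarrow> ('e \<Rightarrow> 'c) \<Rightarrow> nat" where
  "max_colors V E ends C = Max (num_colors_at E ends C ` V)"

definition opt_colors ::
  "'v set \<Rightarrow> 'e set \<Rightarrow> ('e \<Rightarrow> 'v set) \<Rightarrow> ('v \<Rightarrow> nat) \<Rightarrow> ('v \<Rightarrow> 'c) \<Rightarrow> nat" where
  "opt_colors V E ends \<kappa> nc =
     (LEAST k. \<exists>C. valid_star_coloring V E ends \<kappa> nc C \<and> max_colors V E ends C = k)"

end

theory Submission
  imports Defs
begin

text \<open>
  Take any optimal valid star coloring and recolor each class of parallel edges with the color
  of one of its members. Parallel edges meet the same nodes, so the representative's color was
  already present at every node that the class meets: the set of colors at a node can only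
  shrink (lemma \<open>num_colors_at_uniform_coloring_le\<close>). Hence validity is preserved and the
  maximum does not grow, and by optimality it cannot drop either.
\<close>

definition uniform_coloring ::
  "'e set \<Rightarrow> ('e \<Rightarrow> 'v set) \<Rightarrow> ('e \<Rightarrow> 'c) \<Rightarrow> 'e \<Rightarrow> 'c" where
  "uniform_coloring E ends C e = C (SOME f. f \<in> E \<and> ends f = ends e)"

lemma uniform_coloring_cong:
  "ends e = ends f \<Longrightarrow> uniform_coloring E ends C e = uniform_coloring E ends C f"
  by (simp add: uniform_coloring_def)

lemma uniform_coloring_representative:
  assumes "e \<in> E"
  obtains f where "f \<in> E" and "ends f = ends e" and "uniform_coloring E ends C e = C f"
proof -
  have "\<exists>f. f \<in> E \<and> ends f = ends e" using assms by blast
  from someI_ex[OF this] show thesis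
    by (intro that) (auto simp: uniform_coloring_def)
qed

lemma star_coloring_uniform_coloring:
  assumes "star_coloring E ends nc C"
  shows "star_coloring E ends nc (uniform_coloring E ends C)"
  unfolding star_coloring_def
proof
  fix e assume "e \<in> E"
  then obtain f where "f \<in> E" "ends f = ends e" "uniform_coloring E ends C e = C f"
    by (rule uniform_coloring_representative)
  then show "\<exists>v\<in>ends e. uniform_coloring E ends C e = nc v"
    using assms unfolding star_coloring_def by metis
qed

lemma num_colors_at_uniform_coloring_le:
  assumes "finite E"
  shows "num_colors_at E ends (uniform_coloring E ends C) v \<le> num_colors_at E ends C v"
  unfolding num_colors_at_def
proof (rule card_mono)
  show "finite (C ` {e \<in> E. v \<in> ends e})" using assms by simp
  show "uniform_coloring E ends C ` {e \<in> E. v \<in> ends e} \<subseteq> C ` {e \<in> E. v \<in> ends e}"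
  proof (rule image_subsetI)
    fix e assume e: "e \<in> {e \<in> E. v \<in> ends e}"
    then have "e \<in> E" by simp
    then obtain f where "f \<in> E" "ends f = ends e" "uniform_coloring E ends C e = C f"
      by (rule uniform_coloring_representative)
    then show "uniform_coloring E ends C e \<in> C ` {e \<in> E. v \<in> ends e}"
      using e by auto
  qed
qed

lemma valid_star_coloring_uniform_coloring:
  assumes "finite E" and "valid_star_coloring V E ends \<kappa> nc C"
  shows "valid_star_coloring V E ends \<kappa> nc (uniform_coloring E ends C)"
  unfolding valid_star_coloring_def
proof (intro conjI ballI)
  show "star_coloring E ends nc (uniform_coloring E ends C)"
    using assms(2) unfolding valid_star_coloring_def
    by (blast intro: star_coloring_uniform_coloring)
  fix v assume "v \<in> V"
  then have "num_colors_at E ends C v \<le> \<kappa> v"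
    using assms(2) by (simp add: valid_star_coloring_def)
  with num_colors_at_uniform_coloring_le[OF assms(1)]
  show "num_colors_at E ends (uniform_coloring E ends C) v \<le> \<kappa> v"
    by (rule order_trans)
qed

lemma max_colors_uniform_coloring_le:
  assumes "finite V" and "V \<noteq> {}" and "finite E"
  shows "max_colors V E ends (uniform_coloring E ends C) \<le> max_colors V E ends C"
proof -
  have "num_colors_at E ends (uniform_coloring E ends C) v
      \<le> Max (num_colors_at E ends C ` V)" if "v \<in> V" for v
    using num_colors_at_uniform_coloring_le[OF assms(3)]
    by (rule order_trans) (use assms(1) that in simp)
  then show ?thesis
    using assms(1,2) by (simp add: max_colors_def)
qed

lemma opt_colors_attained:
  assumes "\<exists>C. valid_star_coloring V E ends \<kappa> nc C"
  obtains C where "valid_star_coloring V E ends \<kappa> nc C"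
    and "max_colors V E ends C = opt_colors V E ends \<kappa> nc"
proof -
  have "\<exists>k C. valid_star_coloring V E ends \<kappa> nc C \<and> max_colors V E ends C = k"
    using assms by blast
  from LeastI_ex[OF this] show thesis
    using that unfolding opt_colors_def by blast
qed

lemma opt_colors_le:
  assumes "valid_star_coloring V E ends \<kappa> nc C"
  shows "opt_colors V E ends \<kappa> nc \<le> max_colors V E ends C"
  unfolding opt_colors_def by (rule Least_le) (use assms in blast)

theorem mainTheorem9:
  fixes V :: "'v set" and E :: "'e set" and ends :: "'e \<Rightarrow> 'v set"
    and \<kappa> :: "'v \<Rightarrow> nat" and nc :: "'v \<Rightarrow> 'c"
  assumes "finite_multigraph V E ends"
    and "connected_multigraph V E ends"
    and "inj_on nc V"
    and "\<exists>C. valid_star_coloring V E ends \<kappa> nc C"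
  shows "\<exists>C. valid_star_coloring V E ends \<kappa> nc C \<and>
             max_colors V E ends C = opt_colors V E ends \<kappa> nc \<and>
             (\<forall>e f. parallel_edges E ends e f \<longrightarrow> C e = C f)"
proof -
  have fin: "finite V" "finite E" and ne: "V \<noteq> {}"
    using assms(1,2) by (auto simp: finite_multigraph_def connected_multigraph_def)
  obtain C where C: "valid_star_coloring V E ends \<kappa> nc C"
    and opt: "max_colors V E ends C = opt_colors V E ends \<kappa> nc"
    using opt_colors_attained[OF assms(4)] by blast
  let ?U = "uniform_coloring E ends C"
  have valid: "valid_star_coloring V E ends \<kappa> nc ?U"
    using valid_star_coloring_uniform_coloring[OF fin(2) C] .
  moreover have "max_colors V E ends ?U = opt_colors V E ends \<kappa> nc"
    using max_colors_uniform_coloring_le[OF fin(1) ne fin(2), of ends C]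
      opt_colors_le[OF valid] opt by linarith
  moreover have "\<forall>e f. parallel_edges E ends e f \<longrightarrow> ?U e = ?U f"
    by (auto simp: parallel_edges_def intro: uniform_coloring_cong)
  ultimately show ?thesis by blast
qed

end
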